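(* Let $\sigma\in\mathbb R$, let $V:\mathbb R\to\mathbb R$ be smooth, and let $\hat u(z,k)$ be a family of functions, $2\pi$-periodic in $z$ and depending smoothly on $(z,k)$ for $k$ in an open interval of nonzero real numbers, such that for each $k$ $$k^4\hat u_{zzzz}+\sigma k^2\hat u_{zz}+V'(\hat u)=0 .$$ Let $H(k)$ and $A(k)$ be the Hamiltonian and the action evaluated on this family, $$H(k)=k^4\hat u_z\hat u_{zzz}-\tfrac12k^4\hat u_{zz}^2+\tfrac12\sigma k^2\hat u_z^2+V(\hat u),\qquad A(k)=\frac1{2\pi}\int_0^{2\pi}\big(\sigma k\,\hat u_z^2-2k^3\hat u_{zz}^2\big)\,dz .$$ Then $$\frac{dH}{dk}=k\,\frac{dA}{dk}.$$
   Context: The functions $u(x)=\hat u(kx,k)$ are periodic solutions, of wavenumber $k$, of the ODE $u_{xxxx}+\sigma u_{xx}+V'(u)=0$. The function $H=u_xu_{xxx}-\tfrac12u_{xx}^2+\tfrac12\sigma u_x^2+V(u)$ is constant in $x$ along solutions of this ODE, so the expression defining $H(k)$ does not depend on $z$. *)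

theory Defs
  imports "HOL-Analysis.Analysis"
begin

text \<open>Continuous differentiability of finite order and smoothness, meant for open \<open>S\<close>. The step
  requires every directional derivative to have one order less; on finite-dimensional domains this
  is the usual notion of class \<open>C\<close> to the \<open>n\<close>.\<close>

primrec Ck_on :: "nat \<Rightarrow> 'a::real_normed_vector set \<Rightarrow> ('a \<Rightarrow> 'b::real_normed_vector) \<Rightarrow> bool" where
  "Ck_on 0 S f \<longleftrightarrow> continuous_on S f"
| "Ck_on (Suc n) S f \<longleftrightarrow>
     (\<forall>x\<in>S. f differentiable (at x)) \<and> (\<forall>v. Ck_on n S (\<lambda>x. frechet_derivative f (at x) v))"

definition smooth_on :: "'a::real_normed_vector set \<Rightarrow> ('a \<Rightarrow> 'b::real_normed_vector) \<Rightarrow> bool" where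
  "smooth_on S f \<longleftrightarrow> (\<forall>n. Ck_on n S f)"

definition dz :: "nat \<Rightarrow> (real \<Rightarrow> real \<Rightarrow> real) \<Rightarrow> real \<Rightarrow> real \<Rightarrow> real" where
  "dz n u z k = (deriv ^^ n) (\<lambda>y. u y k) z"

definition hamiltonian_at ::
    "real \<Rightarrow> (real \<Rightarrow> real) \<Rightarrow> (real \<Rightarrow> real \<Rightarrow> real) \<Rightarrow> real \<Rightarrow> real \<Rightarrow> real" where
  "hamiltonian_at \<sigma> V u z k =
     k ^ 4 * dz 1 u z k * dz 3 u z k - 1 / 2 * k ^ 4 * (dz 2 u z k)\<^sup>2
       + 1 / 2 * \<sigma> * k\<^sup>2 * (dz 1 u z k)\<^sup>2 + V (u z k)"

text \<open>Along solutions the expression above is constant in \<open>z\<close>; the Hamiltonian as a function of the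
  wavenumber alone is its common value, unspecified if there is none.\<close>

definition hamiltonian ::
    "real \<Rightarrow> (real \<Rightarrow> real) \<Rightarrow> (real \<Rightarrow> real \<Rightarrow> real) \<Rightarrow> real \<Rightarrow> real" where
  "hamiltonian \<sigma> V u k = (THE h. \<forall>z. hamiltonian_at \<sigma> V u z k = h)"

definition action :: "real \<Rightarrow> (real \<Rightarrow> real \<Rightarrow> real) \<Rightarrow> real \<Rightarrow> real" where
  "action \<sigma> u k =
     1 / (2 * pi) * integral {0..2 * pi} (\<lambda>z. \<sigma> * k * (dz 1 u z k)\<^sup>2 - 2 * k ^ 3 * (dz 2 u z k)\<^sup>2)"

end

theory Submission
  imports Defs
begin

text \<open>Write \<open>w = u\<^sub>k\<close>, let \<open>h(z,k)\<close> be the expression defining the Hamiltonian and \<open>a(z,k)\<close> the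
  integrand of the action. Multiplying the equation by \<open>u\<^sub>z\<close> gives \<open>h\<^sub>z = 0\<close>, so \<open>h\<close> is a function
  of \<open>k\<close> alone. Its derivative \<open>h\<^sub>k\<close> contains \<open>V'(u) w\<close>; once the equation has been used to
  eliminate \<open>V'(u)\<close>, the difference \<open>h\<^sub>k - k a\<^sub>k\<close> is an exact \<open>z\<close>-derivative \<open>G\<^sub>z\<close> of
  \[ G = 4 k^3 u_z u_{zz} + k^4 (u_z w_{zz} - u_{zzz} w + 2 u_{zz} w_z) - \sigma k^2 u_z w. \]
  Since \<open>G\<close> is \<open>2\<pi>\<close>-periodic in \<open>z\<close>, averaging over a period leaves \<open>H'(k) = k A'(k)\<close>
  (lemmas \<open>hamiltonian_at_has_k_derivative\<close> and \<open>flux_has_z_derivative\<close>).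

  Computing \<open>G\<^sub>z\<close> requires \<open>z\<close>- and \<open>k\<close>-derivatives of \<open>u\<close> to commute. This and the
  differentiability of \<open>A\<close> both come from differentiation under the integral sign: the
  \<open>k\<close>-derivative of \<open>p(y,k) - p(a,k) = \<integral>\<^sub>a\<^sup>y p\<^sub>z\<close> exhibits \<open>p\<^sub>k\<close> as a primitive of \<open>p\<^sub>z\<^sub>k\<close>
  (lemma \<open>mixed_partial\<close>).\<close>

section \<open>Partial derivatives of smooth functions on a strip\<close>

definition dk :: "(real \<Rightarrow> real \<Rightarrow> real) \<Rightarrow> real \<Rightarrow> real \<Rightarrow> real" where
  "dk p z k = deriv (p z) k"

lemma smooth_on_differentiable:
  assumes "smooth_on S f" and "x \<in> S"
  shows "f differentiable (at x)"
proof -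
  have "Ck_on (Suc 0) S f" using assms(1) unfolding smooth_on_def by blast
  then show ?thesis using assms(2) by simp
qed

lemma smooth_on_continuous: "smooth_on S f \<Longrightarrow> continuous_on S f"
  unfolding smooth_on_def by (drule spec[of _ 0]) simp

lemma smooth_on_directional_derivative:
  assumes "smooth_on S f"
  shows "smooth_on S (\<lambda>x. frechet_derivative f (at x) v)"
  unfolding smooth_on_def
proof
  fix n
  have "Ck_on (Suc n) S f" using assms unfolding smooth_on_def by blast
  then show "Ck_on n S (\<lambda>x. frechet_derivative f (at x) v)" by simp
qed

text \<open>Derivatives of a function on an open set see only its values there. This matters because
  the partial derivatives below are identified with directional derivatives on the strip only.\<close>

lemma Ck_on_transform:
  assumes "open S" and "Ck_on n S f" and "\<And>x. x \<in> S \<Longrightarrow> f x = g x"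
  shows "Ck_on n S g"
  using assms(2,3)
proof (induction n arbitrary: f g)
  case 0
  then show ?case using continuous_on_cong[of S S f g] by simp
next
  case (Suc n)
  have der: "(g has_derivative frechet_derivative f (at x)) (at x)" if "x \<in> S" for x
  proof -
    have "(f has_derivative frechet_derivative f (at x)) (at x)"
      using Suc.prems(1) that frechet_derivative_works by auto
    then show ?thesis
      using has_derivative_transform_within_open[OF _ assms(1) that] Suc.prems(2) by blast
  qed
  have "Ck_on n S (\<lambda>x. frechet_derivative g (at x) v)" for v
  proof (rule Suc.IH)
    show "Ck_on n S (\<lambda>x. frechet_derivative f (at x) v)" using Suc.prems(1) by simp
    show "frechet_derivative f (at x) v = frechet_derivative g (at x) v" if "x \<in> S" for x
      using frechet_derivative_at[OF der[OF that]] by simp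
  qed
  then show ?case using differentiableI[OF der] by simp
qed

lemma smooth_on_transform:
  "open S \<Longrightarrow> smooth_on S f \<Longrightarrow> (\<And>x. x \<in> S \<Longrightarrow> f x = g x) \<Longrightarrow> smooth_on S g"
  unfolding smooth_on_def using Ck_on_transform by blast

lemma smooth_on_has_derivative:
  "smooth_on S f \<Longrightarrow> x \<in> S \<Longrightarrow> (f has_derivative frechet_derivative f (at x)) (at x)"
  using smooth_on_differentiable frechet_derivative_works by blast

lemma has_derivative_imp_has_z_derivative:
  fixes p :: "real \<Rightarrow> real \<Rightarrow> real"
  assumes "((\<lambda>(z, k). p z k) has_derivative D) (at (z, k))"
  shows "((\<lambda>y. p y k) has_real_derivative D (1, 0)) (at z)"
proof -
  have line: "((\<lambda>y. (y, k)) has_derivative (\<lambda>h. (h, 0))) (at z)"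
    by (rule has_derivative_Pair[OF has_derivative_ident has_derivative_const])
  have "((\<lambda>y. p y k) has_derivative (\<lambda>h. D (h, 0))) (at z)"
    using has_derivative_compose[OF line assms] by simp
  moreover have "(\<lambda>h. D (h, 0)) = (*) (D (1, 0))"
  proof
    show "D (h, 0) = D (1, 0) * h" for h
      using linear_scale[OF has_derivative_linear[OF assms], of h "(1, 0)"] by simp
  qed
  ultimately show ?thesis unfolding has_field_derivative_def by simp
qed

lemma has_derivative_imp_has_k_derivative:
  fixes p :: "real \<Rightarrow> real \<Rightarrow> real"
  assumes "((\<lambda>(z, k). p z k) has_derivative D) (at (z, k))"
  shows "(p z has_real_derivative D (0, 1)) (at k)"
proof -
  have line: "(Pair z has_derivative (\<lambda>h. (0, h))) (at k)"
    by (rule has_derivative_Pair[OF has_derivative_const has_derivative_ident])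
  have "((\<lambda>\<kappa>. p z \<kappa>) has_derivative (\<lambda>h. D (0, h))) (at k)"
    using has_derivative_compose[OF line assms] by simp
  moreover have "(\<lambda>h. D (0, h)) = (*) (D (0, 1))"
  proof
    show "D (0, h) = D (0, 1) * h" for h
      using linear_scale[OF has_derivative_linear[OF assms], of h "(0, 1)"] by simp
  qed
  ultimately show ?thesis unfolding has_field_derivative_def by simp
qed

lemma smooth_on_dz_1:
  assumes "open I" and sm: "smooth_on (UNIV \<times> I) (\<lambda>(z, k). p z k)"
  shows "smooth_on (UNIV \<times> I) (\<lambda>(z, k). dz 1 p z k)"
proof (rule smooth_on_transform)
  show "smooth_on (UNIV \<times> I) (\<lambda>x. frechet_derivative (\<lambda>(z, k). p z k) (at x) (1, 0))"
    by (rule smooth_on_directional_derivative[OF sm])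
  fix x assume "x \<in> (UNIV :: real set) \<times> I"
  then obtain z k where x: "x = (z, k)" "(z, k) \<in> UNIV \<times> I" by (cases x) auto
  show "frechet_derivative (\<lambda>(z, k). p z k) (at x) (1, 0) = (case x of (z, k) \<Rightarrow> dz 1 p z k)"
    using DERIV_imp_deriv[OF has_derivative_imp_has_z_derivative
        [OF smooth_on_has_derivative[OF sm x(2)]]]
    by (simp add: x(1) dz_def)
qed (use assms in \<open>auto intro: open_Times\<close>)

lemma smooth_on_dk:
  assumes "open I" and sm: "smooth_on (UNIV \<times> I) (\<lambda>(z, k). p z k)"
  shows "smooth_on (UNIV \<times> I) (\<lambda>(z, k). dk p z k)"
proof (rule smooth_on_transform)
  show "smooth_on (UNIV \<times> I) (\<lambda>x. frechet_derivative (\<lambda>(z, k). p z k) (at x) (0, 1))"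
    by (rule smooth_on_directional_derivative[OF sm])
  fix x assume "x \<in> (UNIV :: real set) \<times> I"
  then obtain z k where x: "x = (z, k)" "(z, k) \<in> UNIV \<times> I" by (cases x) auto
  show "frechet_derivative (\<lambda>(z, k). p z k) (at x) (0, 1) = (case x of (z, k) \<Rightarrow> dk p z k)"
    using DERIV_imp_deriv[OF has_derivative_imp_has_k_derivative
        [OF smooth_on_has_derivative[OF sm x(2)]]]
    by (simp add: x(1) dk_def)
qed (use assms in \<open>auto intro: open_Times\<close>)

lemma dz_0: "dz 0 u = u"
  by (intro ext) (simp add: dz_def)

lemma dz_Suc: "dz (Suc n) u = dz 1 (dz n u)"
  by (intro ext) (simp add: dz_def)

lemma smooth_on_dz:
  assumes "open I" and "smooth_on (UNIV \<times> I) (\<lambda>(z, k). u z k)"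
  shows "smooth_on (UNIV \<times> I) (\<lambda>(z, k). dz n u z k)"
proof (induction n)
  case 0
  then show ?case using assms by (simp add: dz_0)
next
  case (Suc n)
  then show ?case unfolding dz_Suc[of n u] by (rule smooth_on_dz_1[OF assms(1)])
qed

lemma smooth_on_has_z_derivative:
  assumes sm: "smooth_on (UNIV \<times> I) (\<lambda>(z, k). p z k)" and "k \<in> I"
  shows "((\<lambda>y. p y k) has_real_derivative dz 1 p z k) (at z)"
proof -
  from \<open>k \<in> I\<close> have "(z, k) \<in> UNIV \<times> I" by simp
  from has_derivative_imp_has_z_derivative[OF smooth_on_has_derivative[OF sm this]]
  show ?thesis by (simp add: dz_def DERIV_imp_deriv)
qed

lemma smooth_on_has_k_derivative:
  assumes sm: "smooth_on (UNIV \<times> I) (\<lambda>(z, k). p z k)" and "k \<in> I"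
  shows "(p z has_real_derivative dk p z k) (at k)"
proof -
  from \<open>k \<in> I\<close> have "(z, k) \<in> UNIV \<times> I" by simp
  from has_derivative_imp_has_k_derivative[OF smooth_on_has_derivative[OF sm this]]
  show ?thesis by (simp add: dk_def DERIV_imp_deriv)
qed

text \<open>The existence of \<open>p\<^sub>k\<^sub>z\<close> is part of the conclusion:
  differentiating \<open>p(y,k) - p(a,k) = \<integral>\<^sub>a\<^sup>y p\<^sub>z\<close> under the integral sign gives
  \<open>p\<^sub>k(y,k) - p\<^sub>k(a,k) = \<integral>\<^sub>a\<^sup>y p\<^sub>z\<^sub>k\<close>, and the right-hand side is differentiable in \<open>y\<close>.\<close>

lemma mixed_partial:
  fixes p pz pk pzk :: "real \<Rightarrow> real \<Rightarrow> real"
  assumes "open I" and "convex I" and "k \<in> I"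
    and pz: "\<And>z k. k \<in> I \<Longrightarrow> ((\<lambda>y. p y k) has_real_derivative pz z k) (at z)"
    and pk: "\<And>z k. k \<in> I \<Longrightarrow> (p z has_real_derivative pk z k) (at k)"
    and pzk: "\<And>z k. k \<in> I \<Longrightarrow> (pz z has_real_derivative pzk z k) (at k)"
    and cont: "continuous_on (UNIV \<times> I) (\<lambda>(z, k). pzk z k)"
  shows "((\<lambda>y. pk y k) has_real_derivative pzk z k) (at z)"
proof -
  \<comment> \<open>Any base point below \<open>z\<close> and any end point above it would do: \<open>z\<close> has only to be interior,
    so that the derivative within the interval is an unrestricted one.\<close>
  define a b where "a = z - 1" and "b = z + 1"
  have ftc: "((\<lambda>s. pz s \<kappa>) has_integral p y \<kappa> - p a \<kappa>) {a..y}" if "a \<le> y" "\<kappa> \<in> I" for y \<kappa>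
    using that pz
    by (intro fundamental_theorem_of_calculus)
       (auto simp: has_real_derivative_iff_has_vector_derivative
             intro: has_vector_derivative_at_within)
  have cont': "continuous_on (I \<times> T) (\<lambda>(\<kappa>, s). pzk s \<kappa>)" for T
    using continuous_on_compose2[OF cont continuous_on_swap, of "I \<times> T"]
    by (simp add: case_prod_beta image_subset_iff)
  have primitive: "pk y k - pk a k = integral {a..y} (\<lambda>s. pzk s k)" if "a \<le> y" for y
  proof -
    have "((\<lambda>\<kappa>. integral (cbox a y) (\<lambda>s. pz s \<kappa>)) has_field_derivative
            integral (cbox a y) (\<lambda>s. pzk s k)) (at k within I)"
    proof (rule leibniz_rule_field_derivative[OF _ _ cont' assms(3,2)])
      show "(pz s has_field_derivative pzk s \<kappa>) (at \<kappa> within I)" if "\<kappa> \<in> I" for s \<kappa>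
        by (rule has_field_derivative_at_within[OF pzk[OF that]])
      show "(\<lambda>s. pz s \<kappa>) integrable_on cbox a y" if "\<kappa> \<in> I" for \<kappa>
        using has_integral_integrable[OF ftc[OF \<open>a \<le> y\<close> that]] by simp
    qed
    then have "((\<lambda>\<kappa>. integral {a..y} (\<lambda>s. pz s \<kappa>)) has_field_derivative
            integral {a..y} (\<lambda>s. pzk s k)) (at k)"
      using at_within_open[OF assms(3,1)] by simp
    then have "((\<lambda>\<kappa>. p y \<kappa> - p a \<kappa>) has_field_derivative integral {a..y} (\<lambda>s. pzk s k)) (at k)"
      by (rule has_field_derivative_transform_within_open[OF _ assms(1,3)])
         (rule integral_unique[OF ftc[OF that]])
    moreover have "((\<lambda>\<kappa>. p y \<kappa> - p a \<kappa>) has_field_derivative pk y k - pk a k) (at k)"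
      by (intro derivative_intros pk assms)
    ultimately show ?thesis by (rule DERIV_unique[symmetric])
  qed
  have "continuous_on {a..b} (\<lambda>s. pzk s k)"
    using continuous_on_compose2[OF cont, of "{a..b}" "\<lambda>s. (s, k)"] assms(3)
    by (simp add: image_subset_iff continuous_on_Pair)
  then have "((\<lambda>y. integral {a..y} (\<lambda>s. pzk s k)) has_real_derivative pzk z k)
               (at z within {a..b})"
    by (rule integral_has_real_derivative) (auto simp: a_def b_def)
  moreover have "at z within {a..b} = at z"
    by (rule at_within_interior) (auto simp: a_def b_def)
  ultimately have "((\<lambda>y. integral {a..y} (\<lambda>s. pzk s k)) has_real_derivative pzk z k) (at z)"
    by simp
  from DERIV_add[OF this DERIV_const[of "pk a k"]]
  have "((\<lambda>y. integral {a..y} (\<lambda>s. pzk s k) + pk a k) has_real_derivative pzk z k) (at z)"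
    by simp
  then show ?thesis
  proof (rule has_field_derivative_transform_within_open)
    show "open {a<..<b}" and "z \<in> {a<..<b}" by (simp_all add: a_def b_def)
    show "integral {a..y} (\<lambda>s. pzk s k) + pk a k = pk y k" if "y \<in> {a<..<b}" for y
      using primitive[of y] that by simp
  qed
qed

lemma dk_has_z_derivative:
  assumes "open I" and "convex I" and "k \<in> I"
    and sm: "smooth_on (UNIV \<times> I) (\<lambda>(z, k). u z k)"
  shows "((\<lambda>y. dk (dz n u) y k) has_real_derivative dk (dz (Suc n) u) z k) (at z)"
proof (rule mixed_partial[where p = "dz n u" and pz = "dz (Suc n) u", OF assms(1-3)])
  note sm_dz = smooth_on_dz[OF assms(1) sm]
  show "((\<lambda>y. dz n u y k) has_real_derivative dz (Suc n) u z k) (at z)" if "k \<in> I" for z k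
    unfolding dz_Suc[of n u] by (rule smooth_on_has_z_derivative[OF sm_dz that])
  show "(dz n u z has_real_derivative dk (dz n u) z k) (at k)"
    and "(dz (Suc n) u z has_real_derivative dk (dz (Suc n) u) z k) (at k)" if "k \<in> I" for z k
    by (rule smooth_on_has_k_derivative[OF sm_dz that])+
  show "continuous_on (UNIV \<times> I) (\<lambda>(z, k). dk (dz (Suc n) u) z k)"
    by (rule smooth_on_continuous[OF smooth_on_dk[OF assms(1) sm_dz]])
qed

section \<open>Periodicity\<close>

lemma dz_periodic:
  assumes "\<And>z. u (z + c) k = u z k"
  shows "dz n u (z + c) k = dz n u z k"
proof (induction n arbitrary: z)
  case 0
  then show ?case using assms by (simp add: dz_0)
next
  case (Suc n)
  have "dz (Suc n) u (z + c) k = deriv (\<lambda>y. dz n u y k) (z + c)"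
    by (simp add: dz_def)
  also have "\<dots> = deriv (\<lambda>y. dz n u (y + c) k) z"
    by (simp add: deriv_def DERIV_shift)
  also have "\<dots> = deriv (\<lambda>y. dz n u y k) z"
    by (simp only: Suc.IH)
  also have "\<dots> = dz (Suc n) u z k"
    by (simp add: dz_def)
  finally show ?case .
qed

lemma dk_periodic:
  assumes "open I" and "k \<in> I" and "\<And>z k. k \<in> I \<Longrightarrow> p (z + c) k = p z k"
  shows "dk p (z + c) k = dk p z k"
  unfolding dk_def
proof (rule deriv_cong_ev)
  show "\<forall>\<^sub>F \<kappa> in nhds k. p (z + c) \<kappa> = p z \<kappa>"
    using eventually_nhds_in_open[OF assms(1,2)] by eventually_elim (rule assms(3))
qed simp

section \<open>The Hamiltonian, the action and the flux between them\<close>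

definition action_density :: "real \<Rightarrow> (real \<Rightarrow> real \<Rightarrow> real) \<Rightarrow> real \<Rightarrow> real \<Rightarrow> real" where
  "action_density \<sigma> u z k = \<sigma> * k * (dz 1 u z k)\<^sup>2 - 2 * k ^ 3 * (dz 2 u z k)\<^sup>2"

definition action_density_dk :: "real \<Rightarrow> (real \<Rightarrow> real \<Rightarrow> real) \<Rightarrow> real \<Rightarrow> real \<Rightarrow> real" where
  "action_density_dk \<sigma> u z k =
     \<sigma> * (dz 1 u z k)\<^sup>2 + 2 * \<sigma> * k * dz 1 u z k * dk (dz 1 u) z k
       - 6 * k\<^sup>2 * (dz 2 u z k)\<^sup>2 - 4 * k ^ 3 * dz 2 u z k * dk (dz 2 u) z k"

text \<open>The function \<open>G\<close> above, whose \<open>z\<close>-derivative is \<open>h\<^sub>k - k a\<^sub>k\<close>, with \<open>w = dk u\<close>.\<close>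

definition flux :: "real \<Rightarrow> (real \<Rightarrow> real \<Rightarrow> real) \<Rightarrow> real \<Rightarrow> real \<Rightarrow> real" where
  "flux \<sigma> u z k =
     4 * k ^ 3 * dz 1 u z k * dz 2 u z k
       + k ^ 4 * (dz 1 u z k * dk (dz 2 u) z k - dz 3 u z k * dk u z k
                   + 2 * dz 2 u z k * dk (dz 1 u) z k)
       - \<sigma> * k\<^sup>2 * dz 1 u z k * dk u z k"

text \<open>This is \<open>h\<^sub>k\<close> with \<open>V'(u) w\<close> replaced, by means of the equation, by the last term. In this form
  it is quadratic in \<open>u\<close> and its derivatives, as \<open>a\<^sub>k\<close> is, and the two can be compared without any
  further reference to the equation.\<close>

definition hamiltonian_dk :: "real \<Rightarrow> (real \<Rightarrow> real \<Rightarrow> real) \<Rightarrow> real \<Rightarrow> real \<Rightarrow> real" where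
  "hamiltonian_dk \<sigma> u z k =
     4 * k ^ 3 * dz 1 u z k * dz 3 u z k
       + k ^ 4 * (dk (dz 1 u) z k * dz 3 u z k + dz 1 u z k * dk (dz 3 u) z k)
       - 2 * k ^ 3 * (dz 2 u z k)\<^sup>2 - k ^ 4 * dz 2 u z k * dk (dz 2 u) z k
       + \<sigma> * k * (dz 1 u z k)\<^sup>2 + \<sigma> * k\<^sup>2 * dz 1 u z k * dk (dz 1 u) z k
       - (k ^ 4 * dz 4 u z k + \<sigma> * k\<^sup>2 * dz 2 u z k) * dk u z k"

locale smooth_family =
  fixes u :: "real \<Rightarrow> real \<Rightarrow> real" and I :: "real set"
  assumes open_I: "open I" and convex_I: "convex I"
    and smooth_u: "smooth_on (UNIV \<times> I) (\<lambda>(z, k). u z k)"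
begin

lemma dz_has_z_derivative:
  "k \<in> I \<Longrightarrow> ((\<lambda>y. dz n u y k) has_real_derivative dz (Suc n) u z k) (at z)"
  unfolding dz_Suc[of n u] by (rule smooth_on_has_z_derivative[OF smooth_on_dz[OF open_I smooth_u]])

lemma dz_has_k_derivative:
  "k \<in> I \<Longrightarrow> (dz n u z has_real_derivative dk (dz n u) z k) (at k)"
  by (rule smooth_on_has_k_derivative[OF smooth_on_dz[OF open_I smooth_u]])

lemma dz_z_derivs:
  assumes "k \<in> I"
  shows "((\<lambda>y. u y k) has_real_derivative dz 1 u z k) (at z)"
    and "((\<lambda>y. dz 1 u y k) has_real_derivative dz 2 u z k) (at z)"
    and "((\<lambda>y. dz 2 u y k) has_real_derivative dz 3 u z k) (at z)"
    and "((\<lambda>y. dz 3 u y k) has_real_derivative dz 4 u z k) (at z)"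
  using dz_has_z_derivative[OF assms, of 0 z] dz_has_z_derivative[OF assms, of 1 z]
    dz_has_z_derivative[OF assms, of 2 z] dz_has_z_derivative[OF assms, of 3 z]
  by (simp_all add: dz_0 numeral_eq_Suc)

lemma dz_k_derivs:
  assumes "k \<in> I"
  shows "((\<lambda>\<kappa>. u z \<kappa>) has_real_derivative dk u z k) (at k)"
    and "((\<lambda>\<kappa>. dz n u z \<kappa>) has_real_derivative dk (dz n u) z k) (at k)"
  using dz_has_k_derivative[OF assms, of 0 z] dz_has_k_derivative[OF assms, of n z]
  by (simp_all add: dz_0)

lemma dk_z_derivs:
  assumes "k \<in> I"
  shows "((\<lambda>y. dk u y k) has_real_derivative dk (dz 1 u) z k) (at z)"
    and "((\<lambda>y. dk (dz 1 u) y k) has_real_derivative dk (dz 2 u) z k) (at z)"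
    and "((\<lambda>y. dk (dz 2 u) y k) has_real_derivative dk (dz 3 u) z k) (at z)"
  using dk_has_z_derivative[OF open_I convex_I assms smooth_u, of 0 z]
    dk_has_z_derivative[OF open_I convex_I assms smooth_u, of 1 z]
    dk_has_z_derivative[OF open_I convex_I assms smooth_u, of 2 z]
  by (simp_all add: dz_0 numeral_eq_Suc)

text \<open>The coefficients of \<open>flux\<close> are read off from this identity: the terms in \<open>k\<^sup>3\<close> form
  \<open>4 (u\<^sub>z u\<^sub>z\<^sub>z)\<^sub>z\<close>, those in \<open>k\<^sup>4\<close> form \<open>(u\<^sub>z w\<^sub>z\<^sub>z)\<^sub>z - (u\<^sub>z\<^sub>z\<^sub>z w)\<^sub>z + 2 (u\<^sub>z\<^sub>z w\<^sub>z)\<^sub>z\<close>, and those in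
  \<open>\<sigma> k\<^sup>2\<close> form \<open>- (u\<^sub>z w)\<^sub>z\<close>, while \<open>\<sigma> k u\<^sub>z\<^sup>2\<close> cancels.\<close>

lemma flux_has_z_derivative:
  assumes "k \<in> I"
  shows "((\<lambda>y. flux \<sigma> u y k) has_real_derivative
           hamiltonian_dk \<sigma> u z k - k * action_density_dk \<sigma> u z k) (at z)"
  unfolding flux_def hamiltonian_dk_def action_density_dk_def
  by (rule dz_z_derivs[OF assms] dk_z_derivs[OF assms] derivative_eq_intros refl)+
     (simp add: algebra_simps power2_eq_square power3_eq_cube power4_eq_xxxx)

lemma action_density_has_k_derivative:
  assumes "k \<in> I"
  shows "(action_density \<sigma> u z has_real_derivative action_density_dk \<sigma> u z k) (at k)"
  unfolding action_density_def[abs_def] action_density_dk_def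
  by (rule dz_k_derivs[OF assms] derivative_eq_intros refl)+
     (simp add: algebra_simps power2_eq_square power3_eq_cube)

lemma continuous_on_action_density_dk:
  "continuous_on (I \<times> T) (\<lambda>(k, z). action_density_dk \<sigma> u z k)"
proof -
  have swap: "continuous_on (I \<times> T) (\<lambda>x. p (snd x) (fst x))"
    if "smooth_on (UNIV \<times> I) (\<lambda>(z, k). p z k)" for p :: "real \<Rightarrow> real \<Rightarrow> real"
    using continuous_on_compose2[OF smooth_on_continuous[OF that] continuous_on_swap, of "I \<times> T"]
    by (simp add: case_prod_beta image_subset_iff)
  have "continuous_on (I \<times> T) (\<lambda>x. dz n u (snd x) (fst x))"
    and "continuous_on (I \<times> T) (\<lambda>x. dk (dz n u) (snd x) (fst x))" for n
    by (intro swap smooth_on_dk smooth_on_dz open_I smooth_u)+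
  then show ?thesis
    unfolding case_prod_beta action_density_dk_def by (intro continuous_intros)
qed

lemma action_has_derivative:
  assumes "k \<in> I"
  shows "(action \<sigma> u has_real_derivative
           1 / (2 * pi) * integral {0..2 * pi} (\<lambda>z. action_density_dk \<sigma> u z k)) (at k)"
proof -
  have "(\<lambda>z. action_density \<sigma> u z \<kappa>) integrable_on cbox 0 (2 * pi)" if "\<kappa> \<in> I" for \<kappa>
  proof -
    have "continuous_on {0..2 * pi} (\<lambda>z. dz n u z \<kappa>)" for n
      by (rule DERIV_continuous_on[OF has_field_derivative_at_within[OF dz_has_z_derivative[OF that]]])
    then show ?thesis
      unfolding action_density_def box_real
      by (intro integrable_continuous_interval continuous_intros)
  qed
  then have "((\<lambda>\<kappa>. integral (cbox 0 (2 * pi)) (\<lambda>z. action_density \<sigma> u z \<kappa>)) has_field_derivative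
          integral (cbox 0 (2 * pi)) (\<lambda>z. action_density_dk \<sigma> u z k)) (at k within I)"
    by (intro leibniz_rule_field_derivative continuous_on_action_density_dk
        has_field_derivative_at_within[OF action_density_has_k_derivative] convex_I assms)
  then have "((\<lambda>\<kappa>. integral {0..2 * pi} (\<lambda>z. action_density \<sigma> u z \<kappa>)) has_field_derivative
          integral {0..2 * pi} (\<lambda>z. action_density_dk \<sigma> u z k)) (at k)"
    using at_within_open[OF assms open_I] by simp
  then show ?thesis
    unfolding action_def[abs_def] action_density_def by (rule DERIV_cmult)
qed

end

locale smooth_solution_family = smooth_family +
  fixes \<sigma> :: real and V :: "real \<Rightarrow> real"
  assumes V_deriv: "\<And>x. (V has_real_derivative deriv V x) (at x)"
    and equation: "\<And>k z. k \<in> I \<Longrightarrow>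
          k ^ 4 * dz 4 u z k + \<sigma> * k\<^sup>2 * dz 2 u z k + deriv V (u z k) = 0"
begin

lemma hamiltonian_at_has_zero_z_derivative:
  assumes "k \<in> I"
  shows "((\<lambda>y. hamiltonian_at \<sigma> V u y k) has_real_derivative 0) (at z)"
proof -
  have V_eq: "deriv V (u z k) = - (k ^ 4 * dz 4 u z k + \<sigma> * k\<^sup>2 * dz 2 u z k)"
    using equation[OF assms, of z] by linarith
  show ?thesis
    unfolding hamiltonian_at_def
    by (rule dz_z_derivs[OF assms] DERIV_chain2[OF V_deriv] derivative_eq_intros refl)+
       (simp add: V_eq algebra_simps power2_eq_square power4_eq_xxxx)
qed

lemma hamiltonian_eq:
  assumes "k \<in> I"
  shows "hamiltonian \<sigma> V u k = hamiltonian_at \<sigma> V u z k"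
proof -
  have "hamiltonian_at \<sigma> V u y k = hamiltonian_at \<sigma> V u z k" for y
    using DERIV_isconst_all[of "\<lambda>y. hamiltonian_at \<sigma> V u y k"]
      hamiltonian_at_has_zero_z_derivative[OF assms] by blast
  then show ?thesis unfolding hamiltonian_def by (intro the_equality) auto
qed

lemma hamiltonian_at_has_k_derivative:
  assumes "k \<in> I"
  shows "(hamiltonian_at \<sigma> V u z has_real_derivative hamiltonian_dk \<sigma> u z k) (at k)"
proof -
  have V_eq: "deriv V (u z k) = - (k ^ 4 * dz 4 u z k + \<sigma> * k\<^sup>2 * dz 2 u z k)"
    using equation[OF assms, of z] by linarith
  show ?thesis
    unfolding hamiltonian_at_def[abs_def] hamiltonian_dk_def
    by (rule dz_k_derivs[OF assms] DERIV_chain2[OF V_deriv] derivative_eq_intros refl)+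
       (simp add: V_eq algebra_simps power2_eq_square power3_eq_cube power4_eq_xxxx)
qed

text \<open>The derivative may be evaluated at any \<open>z\<close>; hence \<open>hamiltonian_dk\<close> is constant
  in \<open>z\<close> and equals its own average.\<close>

lemma hamiltonian_has_derivative:
  assumes "k \<in> I"
  shows "(hamiltonian \<sigma> V u has_real_derivative hamiltonian_dk \<sigma> u z k) (at k)"
  by (rule has_field_derivative_transform_within_open
        [OF hamiltonian_at_has_k_derivative[OF assms] open_I assms])
     (rule hamiltonian_eq[symmetric])

lemma hamiltonian_dk_eq_action_derivative:
  assumes "k \<in> I" and per: "\<And>k z. k \<in> I \<Longrightarrow> u (z + 2 * pi) k = u z k"
  shows "hamiltonian_dk \<sigma> u 0 k =
           k * (1 / (2 * pi) * integral {0..2 * pi} (\<lambda>z. action_density_dk \<sigma> u z k))"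
proof -
  let ?a = "\<lambda>z. action_density_dk \<sigma> u z k"
  have const: "hamiltonian_dk \<sigma> u z k = hamiltonian_dk \<sigma> u 0 k" for z
    by (rule DERIV_unique[OF hamiltonian_has_derivative hamiltonian_has_derivative]) fact+
  have per_dz: "dz n u (2 * pi) \<kappa> = dz n u 0 \<kappa>" if "\<kappa> \<in> I" for n \<kappa>
    using dz_periodic[of u "2 * pi" \<kappa> n 0] per[OF that] by simp
  have per_dk: "dk (dz n u) (2 * pi) k = dk (dz n u) 0 k" for n
    using dk_periodic[OF open_I assms(1), of "dz n u" "2 * pi" 0] dz_periodic[of u "2 * pi"] per
    by simp
  have "flux \<sigma> u (2 * pi) k = flux \<sigma> u 0 k"
    unfolding flux_def using per_dz[OF assms(1)] per_dk per_dk[of 0] by (simp add: dz_0)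
  moreover have "((\<lambda>y. flux \<sigma> u y k) has_real_derivative hamiltonian_dk \<sigma> u 0 k - k * ?a z) (at z)"
    for z
    using flux_has_z_derivative[OF assms(1), of \<sigma> z] const[of z] by simp
  then have "((\<lambda>z. hamiltonian_dk \<sigma> u 0 k - k * ?a z) has_integral
      flux \<sigma> u (2 * pi) k - flux \<sigma> u 0 k) {0..2 * pi}"
    by (intro fundamental_theorem_of_calculus)
       (auto simp: has_real_derivative_iff_has_vector_derivative
             intro: has_vector_derivative_at_within)
  ultimately have flux0: "((\<lambda>z. hamiltonian_dk \<sigma> u 0 k - k * ?a z) has_integral 0) {0..2 * pi}"
    by simp
  have "continuous_on {0..2 * pi} ?a"
    using continuous_on_compose2[OF continuous_on_action_density_dk[of UNIV \<sigma>],
        of "{0..2 * pi}" "\<lambda>z. (k, z)"] assms(1)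
    by (simp add: image_subset_iff continuous_on_Pair)
  then have "(?a has_integral integral {0..2 * pi} ?a) {0..2 * pi}"
    by (intro integrable_integral integrable_continuous_interval)
  then have "((\<lambda>z. hamiltonian_dk \<sigma> u 0 k - k * ?a z) has_integral
      2 * pi * hamiltonian_dk \<sigma> u 0 k - k * integral {0..2 * pi} ?a) {0..2 * pi}"
    using has_integral_const_real[of "hamiltonian_dk \<sigma> u 0 k" 0 "2 * pi"]
    by (intro has_integral_diff has_integral_mult_right) simp_all
  from has_integral_unique[OF this flux0] show ?thesis by (simp add: field_simps)
qed

end

theorem lemma3p1:
  fixes \<sigma> :: real and V :: "real \<Rightarrow> real" and u :: "real \<Rightarrow> real \<Rightarrow> real" and I :: "real set"
  assumes "smooth_on UNIV V"
    and "open I" and "is_interval I" and "0 \<notin> I"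
    and "smooth_on (UNIV \<times> I) (\<lambda>(z, k). u z k)"
    and "\<And>k z. k \<in> I \<Longrightarrow> u (z + 2 * pi) k = u z k"
    and "\<And>k z. k \<in> I \<Longrightarrow>
           k ^ 4 * dz 4 u z k + \<sigma> * k\<^sup>2 * dz 2 u z k + deriv V (u z k) = 0"
  shows "\<forall>k\<in>I. hamiltonian \<sigma> V u differentiable (at k) \<and> action \<sigma> u differentiable (at k) \<and>
           deriv (hamiltonian \<sigma> V u) k = k * deriv (action \<sigma> u) k"
proof
  fix k assume k: "k \<in> I"
  have "(V has_real_derivative deriv V x) (at x)" for x
    using smooth_on_differentiable[OF assms(1), of x]
    by (simp add: real_differentiable_def DERIV_deriv_iff_real_differentiable)
  then interpret smooth_solution_family u I \<sigma> V
    using assms by unfold_locales (auto simp: is_interval_convex)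
  note H = hamiltonian_has_derivative[OF k, of 0] and A = action_has_derivative[OF k, of \<sigma>]
  have "deriv (hamiltonian \<sigma> V u) k = k * deriv (action \<sigma> u) k"
    unfolding DERIV_imp_deriv[OF H] DERIV_imp_deriv[OF A]
    by (rule hamiltonian_dk_eq_action_derivative[OF k assms(6)])
  then show "hamiltonian \<sigma> V u differentiable (at k) \<and> action \<sigma> u differentiable (at k) \<and>
      deriv (hamiltonian \<sigma> V u) k = k * deriv (action \<sigma> u) k"
    using H A real_differentiable_def by blast
qed

end
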